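(* Let $V$ be a finite set with $n=|V|$, let $k\ge 2$ be an integer with $n>k$, and let $P=\{1,\dots,k\}$. Let $\mathcal{R}^{z}_{\mathrm{BQO}}\subset\mathbb{R}^{n\times k}\times\mathbb{R}^{\binom{n}{2}}$ and $\mathcal{R}_{\mathrm{E\text{-}MILO}}\subset\mathbb{R}^{\binom{n}{2}}$ be the sets defined in the context, and let $\operatorname{proj}_{z}\mathcal{R}^{z}_{\mathrm{BQO}}=\{z : \exists x,\ (x,z)\in\mathcal{R}^{z}_{\mathrm{BQO}}\}$. Then $\operatorname{proj}_{z}\mathcal{R}^{z}_{\mathrm{BQO}}$ is a proper subset of $\mathcal{R}_{\mathrm{E\text{-}MILO}}$, i.e. $\operatorname{proj}_{z}\mathcal{R}^{z}_{\mathrm{BQO}}\subset\mathcal{R}_{\mathrm{E\text{-}MILO}}$ with strict inclusion.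
   Context: $V$ is the vertex set of the graph in a max $k$-cut instance. For a set $S$, $\binom{S}{2}$ denotes the set of all 2-element subsets of $S$. Coordinates: $x=(x_{vj})_{v\in V,\,j\in P}$ and $z=(z_{uv})_{\{u,v\}\in\binom{V}{2}}$, where $z_{uv}$ is indexed by the unordered pair $\{u,v\}$. The lifted continuous relaxation of the binary quadratic optimization (BQO) formulation in $z$-space is $$\mathcal{R}^{z}_{\mathrm{BQO}}=\Big\{(x,z)\in[0,1]^{n\times k}\times\mathbb{R}^{\binom{n}{2}} : \sum_{j\in P}x_{vj}=1\ \ \forall v\in V,\quad z_{uv}=\sum_{j\in P}x_{uj}x_{vj}\ \ \forall\{u,v\}\in\tbinom{V}{2}\Big\}.$$ The continuous relaxation of the edge-based mixed integer linear optimization (E-MILO) formulation is the polytope $\mathcal{R}_{\mathrm{E\text{-}MILO}}$ of all $z\in[0,1]^{\binom{n}{2}}$ such that (a) for all $\{u,v,w\}\subseteq V$ (three distinct vertices): $z_{uv}+z_{vw}\le 1+z_{uw}$, $z_{uw}+z_{uv}\le 1+z_{vw}$, and $z_{vw}+z_{uw}\le 1+z_{uv}$; (b) for all $Q\subseteq V$ with $|Q|=k+1$: $\sum_{\{u,v\}\in\binom{Q}{2}}z_{uv}\ge 1$. *)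

theory Defs
  imports Complex_Main "HOL-Library.FuncSet" "HOL-Library.Ramsey"
begin

text \<open>
  Coordinate spaces are sets of extensional functions: \<open>A \<rightarrow>\<^sub>E UNIV\<close> is \<open>\<real>\<^sup>A\<close>.
  Assignment variables are indexed by \<open>V \<times> {1..k}\<close>, edge variables by the two-element
  subsets \<open>[V]\<^bsup>2\<^esup>\<close> of \<open>V\<close>, so that \<open>z {u, v}\<close> stands for \<open>z\<^sub>u\<^sub>v\<close>.
\<close>

definition R_BQO_z :: "'a set \<Rightarrow> nat \<Rightarrow> (('a \<times> nat \<Rightarrow> real) \<times> ('a set \<Rightarrow> real)) set" where
  "R_BQO_z V k = {(x, z).
     x \<in> V \<times> {1..k} \<rightarrow>\<^sub>E {0..1} \<and>
     z \<in> [V]\<^bsup>2\<^esup> \<rightarrow>\<^sub>E UNIV \<and>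
     (\<forall>v\<in>V. (\<Sum>j\<in>{1..k}. x (v, j)) = 1) \<and>
     (\<forall>u\<in>V. \<forall>v\<in>V. u \<noteq> v \<longrightarrow> z {u, v} = (\<Sum>j\<in>{1..k}. x (u, j) * x (v, j)))}"

definition proj_z :: "('x \<times> 'z) set \<Rightarrow> 'z set" where
  "proj_z R = {z. \<exists>x. (x, z) \<in> R}"

definition R_E_MILO :: "'a set \<Rightarrow> nat \<Rightarrow> ('a set \<Rightarrow> real) set" where
  "R_E_MILO V k = {z.
     z \<in> [V]\<^bsup>2\<^esup> \<rightarrow>\<^sub>E {0..1} \<and>
     (\<forall>u\<in>V. \<forall>v\<in>V. \<forall>w\<in>V. u \<noteq> v \<and> v \<noteq> w \<and> u \<noteq> w \<longrightarrow>
        z {u, v} + z {v, w} \<le> 1 + z {u, w} \<and>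
        z {u, w} + z {u, v} \<le> 1 + z {v, w} \<and>
        z {v, w} + z {u, w} \<le> 1 + z {u, v}) \<and>
     (\<forall>Q. Q \<subseteq> V \<and> card Q = k + 1 \<longrightarrow> (\<Sum>e\<in>[Q]\<^bsup>2\<^esup>. z e) \<ge> 1)}"

end

theory Submission
  imports Defs
begin

text \<open>
  For the inclusion, write \<open>z\<^sub>e = \<Sum>\<^sub>j \<Prod>\<^sub>v\<^sub>\<in>\<^sub>e x\<^sub>v\<^sub>j\<close>; each constraint on \<open>z\<close> then
  follows by summing over the colours \<open>j\<close> an inequality that holds on the unit cube. For the
  triangle constraint it is \<open>ab + bc - ac \<le> b\<close> (lemma \<open>unit_cube_triangle\<close>). For the clique constraint
  it is \<open>\<Sum>\<^sub>v x\<^sub>v - 1 \<le> \<Sum>\<^sub>e \<Prod>\<^sub>v\<^sub>\<in>\<^sub>e x\<^sub>v\<close> (lemma \<open>sum_minus_one_le_sum_pair_products\<close>): summed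
  over \<open>k\<close> colours, the left-hand side is \<open>|Q| - k = 1\<close>.

  For strictness, fix \<open>Q\<^sub>0\<close> with \<open>k + 1\<close> elements and a triple \<open>T \<subseteq> Q\<^sub>0\<close>. Let \<open>z\<close> be \<open>1/3\<close> on the
  pairs in \<open>T\<close>, \<open>0\<close> on the other pairs in \<open>Q\<^sub>0\<close>, and \<open>1/2\<close> on all remaining pairs. No value exceeds
  \<open>1/2\<close>, so the triangle constraints hold. The pairs in \<open>Q\<^sub>0\<close> have total weight \<open>1\<close>, and any other
  set of \<open>k + 1\<close> vertices has a vertex outside \<open>Q\<^sub>0\<close>, whose \<open>k\<close> pairs have weight \<open>k/2 \<ge> 1\<close>.
  If \<open>z\<close> came from some \<open>x\<close>, each of the \<open>k - 2\<close> vertices of \<open>Q\<^sub>0 - T\<close> would use a colour that no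
  other vertex of \<open>Q\<^sub>0\<close> uses, which leaves only two colours for \<open>T\<close>. But with two colours,
  \<open>2 z\<^sub>u\<^sub>v - 1 = (2 x\<^sub>u - 1) (2 x\<^sub>v - 1)\<close>, where \<open>x\<^sub>u\<close> is the weight of the first colour at \<open>u\<close>, so
  the product of these numbers over the three pairs of \<open>T\<close> is a square, whereas it is
  \<open>(-1/3)\<^sup>3 < 0\<close> (lemma \<open>two_colour_triple_not_third\<close>).
\<close>

section \<open>Sums over pairs\<close>

lemma nsets_2_insert:
  assumes "y \<notin> Q"
  shows "[insert y Q]\<^bsup>2\<^esup> = [Q]\<^bsup>2\<^esup> \<union> (\<lambda>u. {y, u}) ` Q"
    and "[Q]\<^bsup>2\<^esup> \<inter> (\<lambda>u. {y, u}) ` Q = {}"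
  using assms by (auto simp: nsets_def card_2_iff doubleton_eq_iff)

lemma sum_nsets_2_insert:
  fixes f :: "'a set \<Rightarrow> real"
  assumes "finite Q" "y \<notin> Q"
  shows "(\<Sum>e\<in>[insert y Q]\<^bsup>2\<^esup>. f e) = (\<Sum>e\<in>[Q]\<^bsup>2\<^esup>. f e) + (\<Sum>u\<in>Q. f {y, u})"
proof -
  have "(\<Sum>e\<in>(\<lambda>u. {y, u}) ` Q. f e) = (\<Sum>u\<in>Q. f {y, u})"
    by (subst sum.reindex) (auto simp: inj_on_def doubleton_eq_iff)
  then show ?thesis
    using assms nsets_2_insert[OF assms(2)] by (simp add: sum.union_disjoint finite_imp_finite_nsets)
qed

lemma sum_minus_one_le_sum_pair_products:
  fixes x :: "'a \<Rightarrow> real"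
  assumes "finite Q" "\<And>v. v \<in> Q \<Longrightarrow> 0 \<le> x v \<and> x v \<le> 1"
  shows "(\<Sum>v\<in>Q. x v) - 1 \<le> (\<Sum>e\<in>[Q]\<^bsup>2\<^esup>. \<Prod>v\<in>e. x v)"
  using assms
proof (induction Q rule: finite_induct)
  case empty
  then show ?case by (simp add: nsets_def sum_nonneg)
next
  case (insert y Q)
  let ?s = "\<Sum>v\<in>Q. x v"
  let ?p = "\<Sum>e\<in>[Q]\<^bsup>2\<^esup>. \<Prod>v\<in>e. x v"
  have y: "0 \<le> x y" "x y \<le> 1" using insert.prems by auto
  have "(\<Sum>u\<in>Q. \<Prod>v\<in>{y, u}. x v) = (\<Sum>u\<in>Q. x y * x u)"
    using insert.hyps by (intro sum.cong refl, subst prod.insert) auto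
  then have eq: "(\<Sum>e\<in>[insert y Q]\<^bsup>2\<^esup>. \<Prod>v\<in>e. x v) = ?p + x y * ?s"
    using insert.hyps by (simp add: sum_nsets_2_insert sum_distrib_left)
  have IH: "?s - 1 \<le> ?p" using insert by auto
  have p0: "0 \<le> ?p"
    using insert.prems by (intro sum_nonneg prod_nonneg) (auto simp: nsets_def)
  have "?s + x y - 1 \<le> ?p + x y * ?s"
  proof (cases "?s \<ge> 1")
    case True
    then have "x y * 1 \<le> x y * ?s" using y by (intro mult_left_mono) auto
    then show ?thesis using IH by simp
  next
    case False
    then have "0 \<le> (1 - ?s) * (1 - x y)" using y by (intro mult_nonneg_nonneg) auto
    then show ?thesis using p0 by (simp add: algebra_simps)
  qed
  then show ?case using eq insert.hyps by (simp add: add_ac)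
qed

section \<open>The inclusion\<close>

lemma unit_cube_triangle:
  fixes a b c :: real
  assumes "0 \<le> a" "a \<le> 1" "0 \<le> b" "b \<le> 1" "0 \<le> c" "c \<le> 1"
  shows "a * b + b * c \<le> b + a * c"
proof (cases "a + c \<le> 1")
  case True
  then have "b * (a + c) \<le> b * 1" using assms by (intro mult_left_mono) auto
  moreover have "0 \<le> a * c" using assms by simp
  ultimately show ?thesis by (simp add: algebra_simps)
next
  case False
  then have "b * (a + c - 1) \<le> 1 * (a + c - 1)" using assms by (intro mult_right_mono) auto
  moreover have "0 \<le> (1 - a) * (1 - c)" using assms by simp
  ultimately show ?thesis by (simp add: algebra_simps)
qed

lemma sum_products_triangle:
  fixes f g h :: "'i \<Rightarrow> real"
  assumes "\<And>j. j \<in> J \<Longrightarrow> 0 \<le> f j \<and> f j \<le> 1" "\<And>j. j \<in> J \<Longrightarrow> 0 \<le> g j \<and> g j \<le> 1"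
    "\<And>j. j \<in> J \<Longrightarrow> 0 \<le> h j \<and> h j \<le> 1" and "(\<Sum>j\<in>J. g j) = 1"
  shows "(\<Sum>j\<in>J. f j * g j) + (\<Sum>j\<in>J. g j * h j) \<le> 1 + (\<Sum>j\<in>J. f j * h j)"
proof -
  have "(\<Sum>j\<in>J. f j * g j + g j * h j) \<le> (\<Sum>j\<in>J. g j + f j * h j)"
    using assms by (intro sum_mono unit_cube_triangle) auto
  then show ?thesis using assms(4) by (simp add: sum.distrib)
qed

lemma proj_R_BQO_subset_R_E_MILO:
  fixes V :: "'a set"
  assumes "finite V"
  shows "proj_z (R_BQO_z V k) \<subseteq> R_E_MILO V k"
proof
  fix z assume "z \<in> proj_z (R_BQO_z V k)"
  then obtain x where x: "x \<in> V \<times> {1..k} \<rightarrow>\<^sub>E {0..1}" and z: "z \<in> [V]\<^bsup>2\<^esup> \<rightarrow>\<^sub>E UNIV"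
    and one: "\<And>v. v \<in> V \<Longrightarrow> (\<Sum>j\<in>{1..k}. x (v, j)) = 1"
    and zx: "\<And>u v. u \<in> V \<Longrightarrow> v \<in> V \<Longrightarrow> u \<noteq> v \<Longrightarrow>
      z {u, v} = (\<Sum>j\<in>{1..k}. x (u, j) * x (v, j))"
    unfolding proj_z_def R_BQO_z_def by auto
  have x01: "0 \<le> x (v, j) \<and> x (v, j) \<le> 1" if "v \<in> V" "j \<in> {1..k}" for v j
    using PiE_mem[OF x, of "(v, j)"] that by auto
  have box: "z e \<in> {0..1}" if "e \<in> [V]\<^bsup>2\<^esup>" for e
  proof -
    obtain u v where e: "e = {u, v}" "u \<noteq> v" "u \<in> V" "v \<in> V"
      using \<open>e \<in> [V]\<^bsup>2\<^esup>\<close> by (auto simp: nsets_def card_2_iff)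
    have "(\<Sum>j\<in>{1..k}. x (u, j) * x (v, j)) \<le> (\<Sum>j\<in>{1..k}. x (u, j))"
      using x01 e by (intro sum_mono mult_left_le) auto
    moreover have "0 \<le> (\<Sum>j\<in>{1..k}. x (u, j) * x (v, j))"
      using x01 e by (intro sum_nonneg mult_nonneg_nonneg) auto
    ultimately show ?thesis using zx[of u v] one[of u] e by auto
  qed
  have tri: "z {u, v} + z {v, w} \<le> 1 + z {u, w}"
    if "u \<in> V" "v \<in> V" "w \<in> V" "u \<noteq> v" "v \<noteq> w" "u \<noteq> w" for u v w
    unfolding zx[OF that(1,2,4)] zx[OF that(2,3,5)] zx[OF that(1,3,6)]
    by (rule sum_products_triangle; use that x01 one in blast)
  have clique: "1 \<le> (\<Sum>e\<in>[Q]\<^bsup>2\<^esup>. z e)" if "Q \<subseteq> V" "card Q = k + 1" for Q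
  proof -
    have "finite Q" using that assms finite_subset by blast
    have "(\<Sum>e\<in>[Q]\<^bsup>2\<^esup>. z e) = (\<Sum>e\<in>[Q]\<^bsup>2\<^esup>. \<Sum>j\<in>{1..k}. \<Prod>v\<in>e. x (v, j))"
    proof (rule sum.cong[OF refl])
      fix e assume "e \<in> [Q]\<^bsup>2\<^esup>"
      then obtain u v where "e = {u, v}" "u \<noteq> v" "u \<in> V" "v \<in> V"
        using \<open>Q \<subseteq> V\<close> by (auto simp: nsets_def card_2_iff)
      then show "z e = (\<Sum>j\<in>{1..k}. \<Prod>v\<in>e. x (v, j))" using zx[of u v] by simp
    qed
    also have "\<dots> = (\<Sum>j\<in>{1..k}. \<Sum>e\<in>[Q]\<^bsup>2\<^esup>. \<Prod>v\<in>e. x (v, j))"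
      by (rule sum.swap)
    also have "\<dots> \<ge> (\<Sum>j\<in>{1..k}. (\<Sum>v\<in>Q. x (v, j)) - 1)"
      using x01 \<open>Q \<subseteq> V\<close> \<open>finite Q\<close>
      by (intro sum_mono sum_minus_one_le_sum_pair_products) auto
    also have "(\<Sum>j\<in>{1..k}. (\<Sum>v\<in>Q. x (v, j)) - 1) = (\<Sum>v\<in>Q. \<Sum>j\<in>{1..k}. x (v, j)) - k"
      by (simp add: sum_subtractf sum.swap[of _ Q])
    also have "(\<Sum>v\<in>Q. \<Sum>j\<in>{1..k}. x (v, j)) = (\<Sum>v\<in>Q. 1)"
      using one \<open>Q \<subseteq> V\<close> by (intro sum.cong) auto
    finally show ?thesis using that by simp
  qed
  have "z \<in> [V]\<^bsup>2\<^esup> \<rightarrow>\<^sub>E {0..1}" using z box by (auto simp: PiE_def Pi_def)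
  moreover have "z {u, v} + z {v, w} \<le> 1 + z {u, w} \<and> z {u, w} + z {u, v} \<le> 1 + z {v, w} \<and>
      z {v, w} + z {u, w} \<le> 1 + z {u, v}"
    if "u \<in> V" "v \<in> V" "w \<in> V" "u \<noteq> v" "v \<noteq> w" "u \<noteq> w" for u v w
    using that tri[of u v w] tri[of w u v] tri[of v w u]
    by (simp add: insert_commute)
  ultimately show "z \<in> R_E_MILO V k"
    unfolding R_E_MILO_def using clique by blast
qed

section \<open>Strictness\<close>

lemma two_colour_triple_not_third:
  fixes f g h :: "'i \<Rightarrow> real"
  assumes J: "card J = 2"
    and one: "(\<Sum>j\<in>J. f j) = 1" "(\<Sum>j\<in>J. g j) = 1" "(\<Sum>j\<in>J. h j) = 1"
    and third: "(\<Sum>j\<in>J. f j * g j) = 1/3" "(\<Sum>j\<in>J. f j * h j) = 1/3"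
      "(\<Sum>j\<in>J. g j * h j) = 1/3"
  shows False
proof -
  obtain p q where pq: "J = {p, q}" "p \<noteq> q" using J by (auto simp: card_2_iff)
  have q: "f q = 1 - f p" "g q = 1 - g p" "h q = 1 - h p" using one pq by auto
  define a b c where abc: "a = 2 * f p - 1" "b = 2 * g p - 1" "c = 2 * h p - 1"
  have "a * b = -1/3" "a * c = -1/3" "b * c = -1/3"
    using third pq unfolding abc by (simp_all add: q algebra_simps)
  moreover have "(a * b) * (a * c) * (b * c) = (a * b * c)\<^sup>2"
    by (simp add: power2_eq_square algebra_simps)
  ultimately have "(a * b * c)\<^sup>2 = -1/27" by simp
  moreover have "(a * b * c)\<^sup>2 \<ge> 0" by simp
  ultimately show False by linarith
qed

text \<open>
  For nonnegative vectors, orthogonality means disjoint supports. Hence each vertex of \<open>D\<close> occupies a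
  colour that is unavailable to the rest of \<open>D \<union> T\<close>, and \<open>|J| - |D|\<close> colours suffice for \<open>T\<close>.
\<close>
lemma orthogonal_vertices_leave_colours:
  fixes x :: "'a \<Rightarrow> 'i \<Rightarrow> real"
  assumes "finite J" "finite D"
    and nonneg: "\<And>v j. v \<in> D \<union> T \<Longrightarrow> j \<in> J \<Longrightarrow> 0 \<le> x v j"
    and one: "\<And>v. v \<in> D \<Longrightarrow> (\<Sum>j\<in>J. x v j) = 1"
    and orth: "\<And>d v. d \<in> D \<Longrightarrow> v \<in> D \<union> T \<Longrightarrow> d \<noteq> v \<Longrightarrow> (\<Sum>j\<in>J. x d j * x v j) = 0"
    and disj: "D \<inter> T = {}"
  obtains J' where "J' \<subseteq> J" "card J' = card J - card D"
    "\<And>v j. v \<in> T \<Longrightarrow> j \<in> J - J' \<Longrightarrow> x v j = 0"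
proof -
  have "\<exists>j\<in>J. x d j \<noteq> 0" if "d \<in> D" for d
    using one[OF that] by (metis sum.neutral zero_neq_one)
  then obtain c where c: "\<And>d. d \<in> D \<Longrightarrow> c d \<in> J \<and> x d (c d) \<noteq> 0" by metis
  have zero: "x v (c d) = 0" if "d \<in> D" "v \<in> D \<union> T" "d \<noteq> v" for d v
  proof -
    have "\<forall>j\<in>J. x d j * x v j = 0"
      using orth[OF that] nonneg that \<open>finite J\<close> by (subst (asm) sum_nonneg_eq_0_iff) auto
    then show ?thesis using c[OF that(1)] by auto
  qed
  have "inj_on c D"
    by (rule inj_onI) (metis UnI1 c zero)
  then have "card (J - c ` D) = card J - card D"
    using c \<open>finite D\<close> by (subst card_Diff_subset) (auto simp: card_image)
  moreover have "x v j = 0" if "v \<in> T" "j \<in> J - (J - c ` D)" for v j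
    using that zero disj by blast
  ultimately show ?thesis using that[of "J - c ` D"] by blast
qed

text \<open>
  For a triple \<open>T\<close> inside a set \<open>Q\<close> of \<open>k + 1\<close> vertices of \<open>V\<close>, this point lies in the polytope but
  not in the projection. As a coordinate vector indexed by the pairs in \<open>V\<close>, it is undefined
  elsewhere.
\<close>
definition third_point :: "'a set \<Rightarrow> 'a set \<Rightarrow> 'a set \<Rightarrow> 'a set \<Rightarrow> real" where
  "third_point V Q T =
     (\<lambda>e\<in>[V]\<^bsup>2\<^esup>. if e \<subseteq> T then 1/3 else if e \<subseteq> Q then 0 else 1/2)"

lemma third_point_in_R_E_MILO:
  assumes V: "finite V" and k: "k \<ge> 2"
    and Q: "Q \<subseteq> V" "card Q = k + 1" and T: "T \<subseteq> Q" "card T = 3"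
  shows "third_point V Q T \<in> R_E_MILO V k"
proof -
  let ?z = "third_point V Q T"
  have val: "0 \<le> ?z e \<and> ?z e \<le> 1/2" if "e \<in> [V]\<^bsup>2\<^esup>" for e
    using that by (simp add: third_point_def)
  have half: "0 \<le> ?z {u, v} \<and> ?z {u, v} \<le> 1/2" if "u \<in> V" "v \<in> V" "u \<noteq> v" for u v
    using that by (intro val) (auto simp: nsets_def)
  have clique: "1 \<le> (\<Sum>e\<in>[S]\<^bsup>2\<^esup>. ?z e)" if S: "S \<subseteq> V" "card S = k + 1" for S
  proof -
    have fS: "finite S" using S V finite_subset by blast
    have pos: "0 \<le> ?z e" if "e \<in> [S]\<^bsup>2\<^esup>" for e
      using val[of e] that nsets_mono[OF S(1), of 2] by blast
    show ?thesis
    proof (cases "S = Q")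
      case True
      have sub: "[T]\<^bsup>2\<^esup> \<subseteq> [S]\<^bsup>2\<^esup>" using True T nsets_mono by blast
      have "card ([T]\<^bsup>2\<^esup>) = 3" using T by (simp add: card_nsets numeral_eq_Suc)
      moreover have "(\<Sum>e\<in>[T]\<^bsup>2\<^esup>. ?z e) = (\<Sum>e\<in>[T]\<^bsup>2\<^esup>. 1/3)"
        using T(1) Q(1) by (intro sum.cong refl) (auto simp: third_point_def nsets_def)
      ultimately have "1 = (\<Sum>e\<in>[T]\<^bsup>2\<^esup>. ?z e)" by simp
      also have "\<dots> \<le> (\<Sum>e\<in>[S]\<^bsup>2\<^esup>. ?z e)"
        using sub pos fS by (intro sum_mono2) (auto simp: finite_imp_finite_nsets)
      finally show ?thesis .
    next
      case False
      have "\<not> S \<subseteq> Q"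
        using False S Q V by (metis card_subset_eq finite_subset)
      then obtain w where w: "w \<in> S" "w \<notin> Q" by auto
      define R where "R = S - {w}"
      have R: "S = insert w R" "w \<notin> R" "finite R" "card R = k"
        using w fS S by (auto simp: R_def)
      have "k / 2 = (\<Sum>u\<in>R. 1/2 :: real)" using R by simp
      also have "\<dots> = (\<Sum>u\<in>R. ?z {w, u})"
        using R S w T by (intro sum.cong refl) (auto simp: third_point_def nsets_def card_2_iff)
      also have "\<dots> \<le> (\<Sum>e\<in>[R]\<^bsup>2\<^esup>. ?z e) + (\<Sum>u\<in>R. ?z {w, u})"
        using pos nsets_mono[of R S 2] R by (simp add: sum_nonneg subset_iff)
      also have "\<dots> = (\<Sum>e\<in>[S]\<^bsup>2\<^esup>. ?z e)"
        using R by (simp add: sum_nsets_2_insert)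
      finally show ?thesis using k by linarith
    qed
  qed
  have "?z \<in> [V]\<^bsup>2\<^esup> \<rightarrow>\<^sub>E {0..1}"
    by (auto simp: third_point_def)
  moreover have "?z {u, v} + ?z {v, w} \<le> 1 + ?z {u, w} \<and> ?z {u, w} + ?z {u, v} \<le> 1 + ?z {v, w} \<and>
      ?z {v, w} + ?z {u, w} \<le> 1 + ?z {u, v}"
    if "u \<in> V" "v \<in> V" "w \<in> V" "u \<noteq> v" "v \<noteq> w" "u \<noteq> w" for u v w
    using half[of u v] half[of v w] half[of u w] that by linarith
  ultimately show ?thesis unfolding R_E_MILO_def using clique by blast
qed

lemma third_point_notin_proj_R_BQO:
  assumes V: "finite V"
    and Q: "Q \<subseteq> V" "card Q = k + 1" and T: "T \<subseteq> Q" "card T = 3"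
  shows "third_point V Q T \<notin> proj_z (R_BQO_z V k)"
proof
  assume "third_point V Q T \<in> proj_z (R_BQO_z V k)"
  then obtain x where x: "x \<in> V \<times> {1..k} \<rightarrow>\<^sub>E {0..1}"
    and one: "\<And>v. v \<in> V \<Longrightarrow> (\<Sum>j\<in>{1..k}. x (v, j)) = 1"
    and zx: "\<And>u v. u \<in> V \<Longrightarrow> v \<in> V \<Longrightarrow> u \<noteq> v \<Longrightarrow>
      third_point V Q T {u, v} = (\<Sum>j\<in>{1..k}. x (u, j) * x (v, j))"
    unfolding proj_z_def R_BQO_z_def by auto
  have x0: "0 \<le> x (v, j)" if "v \<in> V" "j \<in> {1..k}" for v j
    using PiE_mem[OF x, of "(v, j)"] that by auto
  have fin: "finite Q" "finite T" using V Q T by (meson finite_subset)+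
  have cardD: "card (Q - T) = k - 2" and k: "k \<ge> 2"
    using fin T Q card_mono[OF fin(1) T(1)] by (auto simp: card_Diff_subset)
  have orth: "(\<Sum>j\<in>{1..k}. x (d, j) * x (v, j)) = 0"
    if "d \<in> Q - T" "v \<in> (Q - T) \<union> T" "d \<noteq> v" for d v
  proof -
    have "d \<in> V" "v \<in> V" "{d, v} \<subseteq> Q" "\<not> {d, v} \<subseteq> T" using that T Q by auto
    then show ?thesis
      using that zx[of d v] by (auto simp: third_point_def nsets_def)
  qed
  obtain J where J: "J \<subseteq> {1..k}" "card J = card {1..k} - card (Q - T)"
    and vanish: "\<And>v j. v \<in> T \<Longrightarrow> j \<in> {1..k} - J \<Longrightarrow> x (v, j) = 0"
  proof (rule orthogonal_vertices_leave_colours[of "{1..k}" "Q - T" T "\<lambda>v j. x (v, j)"])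
    show "0 \<le> x (v, j)" if "v \<in> (Q - T) \<union> T" "j \<in> {1..k}" for v j
      using that x0 T Q by blast
    show "(\<Sum>j\<in>{1..k}. x (v, j)) = 1" if "v \<in> Q - T" for v
      using that one Q by blast
  qed (use fin orth in auto)
  have J2: "card J = 2" using J(2) cardD k by simp
  have oneJ: "(\<Sum>j\<in>J. x (v, j)) = 1" if "v \<in> T" for v
  proof -
    have "(\<Sum>j\<in>J. x (v, j)) = (\<Sum>j\<in>{1..k}. x (v, j))"
      using J(1) vanish[OF that] by (intro sum.mono_neutral_left) auto
    then show ?thesis using one[of v] that T Q by auto
  qed
  have thirdJ: "(\<Sum>j\<in>J. x (u, j) * x (v, j)) = 1/3" if "u \<in> T" "v \<in> T" "u \<noteq> v" for u v
  proof -
    have "(\<Sum>j\<in>J. x (u, j) * x (v, j)) = (\<Sum>j\<in>{1..k}. x (u, j) * x (v, j))"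
      using J(1) vanish[OF that(1)] by (intro sum.mono_neutral_left) auto
    moreover have "u \<in> V" "v \<in> V" using that T Q by auto
    ultimately show ?thesis
      using zx[of u v] that by (auto simp: third_point_def nsets_def)
  qed
  obtain a b c where abc: "T = {a, b, c}" "a \<noteq> b" "a \<noteq> c" "b \<noteq> c"
    using T(2) by (auto simp: card_3_iff)
  show False
    by (rule two_colour_triple_not_third[OF J2 oneJ[of a] oneJ[of b] oneJ[of c]
          thirdJ[of a b] thirdJ[of a c] thirdJ[of b c]]) (use abc in auto)
qed

theorem theorem3:
  fixes V :: "'a set" and k :: nat
  assumes "finite V" and "k \<ge> 2" and "card V > k"
  shows "proj_z (R_BQO_z V k) \<subset> R_E_MILO V k"
proof -
  obtain Q where Q: "Q \<subseteq> V" "card Q = k + 1"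
    using obtain_subset_with_card_n[of "k + 1" V] assms by auto
  obtain T where T: "T \<subseteq> Q" "card T = 3"
    using obtain_subset_with_card_n[of 3 Q] assms Q by (metis Suc_eq_plus1 Suc_le_mono eval_nat_numeral(3))
  show ?thesis
    using proj_R_BQO_subset_R_E_MILO[OF assms(1)]
      third_point_in_R_E_MILO[OF assms(1,2) Q T] third_point_notin_proj_R_BQO[OF assms(1) Q T]
    by blast
qed

end
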